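(* Let $\mathcal{G}$ be a finite connected graph with universal covering tree $\Delta$ and fundamental group $\Gamma$, and let $\mathfrak{M}$ be an abelian group. If $\mathfrak{M}$ does not have $\chi(\mathcal{G})$-torsion, then $$\mathfrak{D}^\Gamma(\partial\Delta,\mathfrak{M})=\mathfrak{D}^\Gamma_0(\partial\Delta,\mathfrak{M}).$$
   Context: Graphs may have loops and multiple edges. Each geometric edge corresponds to two directed edges, $\delta$ and its reverse $\overline\delta\neq\delta$; each directed edge $\delta$ has an initial vertex $o(\delta)$ and a terminal vertex $t(\delta)$, with $o(\overline\delta)=t(\delta)$. The Euler characteristic is $\chi(\mathcal{G})=n_0-n_1$, where $n_0$ is the number of vertices and $n_1$ the number of geometric edges of $\mathcal{G}$. The group $\mathfrak{M}$ does not have $\chi(\mathcal{G})$-torsion if, for $m\in\mathfrak{M}$, $\chi(\mathcal{G})\cdot m=0$ implies $m=0$. $\Delta$ is the universal covering tree of the finite connected graph $\mathcal{G}$. The fundamental group $\Gamma$ of $\mathcal{G}$ is a free group acting on $\Delta$ (by deck transformations), with quotient $\Gamma\backslash\Delta=\mathcal{G}$. The boundary $\partial\Delta$ is the set of equivalence classes of infinite semi-geodesics in $\Delta$ (infinite one-sided edge paths without backtracking), two semi-geodesics being equivalent if they agree except on finitely many edges. For a directed edge $\delta$ of $\Delta$, $\Omega_\delta\subseteq\partial\Delta$ is the set of classes of semi-geodesics with initial edge $\delta$ and initial vertex $o(\delta)$. The sets $\Omega_\delta$ form a basis of clopen sets for a compact totally disconnected topology on $\partial\Delta$, and $\Gamma$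 acts on $\partial\Delta$. An $\mathfrak{M}$-valued distribution on $\partial\Delta$ is a finitely additive $\mathfrak{M}$-valued measure $\mu$ defined on the clopen subsets of $\partial\Delta$. $\mathfrak{D}^\Gamma(\partial\Delta,\mathfrak{M})$ is the additive group of all $\Gamma$-invariant $\mathfrak{M}$-valued distributions on $\partial\Delta$, and $\mathfrak{D}^\Gamma_0(\partial\Delta,\mathfrak{M})=\{\mu\in\mathfrak{D}^\Gamma(\partial\Delta,\mathfrak{M}):\mu(\partial\Delta)=0\}$. *)

theory Defs
  imports
    "Graph_Theory.Bidirected_Digraph"
    "Graph_Theory.Digraph_Component"
    "HOL-Analysis.Function_Topology"
    "HOL-Algebra.Group"
begin

section \<open>Graphs and Euler characteristic\<close>

text \<open>
  A graph with loops and multiple edges is a \<^locale>\<open>bidirected_digraph\<close>: the arcs are the directed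
  edges, and \<open>arev\<close> is the fixed-point-free reversal (extended by the identity outside
  the arcs). A geometric edge is an unordered pair \<open>{a, arev a}\<close>.
\<close>

definition geom_edges :: "('a, 'b) pre_digraph \<Rightarrow> ('b \<Rightarrow> 'b) \<Rightarrow> 'b set set" where
  "geom_edges G arev = (\<lambda>a. {a, arev a}) ` arcs G"

definition euler_char :: "('a, 'b) pre_digraph \<Rightarrow> ('b \<Rightarrow> 'b) \<Rightarrow> int" where
  "euler_char G arev = int (card (verts G)) - int (card (geom_edges G arev))"

definition int_mult :: "int \<Rightarrow> 'm::ab_group_add \<Rightarrow> 'm" where
  "int_mult k m = (if 0 \<le> k then (\<Sum>i<nat k. m) else - (\<Sum>i<nat (- k). m))"


section \<open>Universal covering tree and fundamental group\<close>

text \<open>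
  Vertices of the universal covering tree based at \<open>v0\<close> are the walks from \<open>v0\<close> without
  backtracking, i.e. the unique reduced representatives of the homotopy classes of walks from \<open>v0\<close>.
  Extending a reduced walk by an arc cancels that arc against a preceding reverse arc.
\<close>

definition reduced :: "('b \<Rightarrow> 'b) \<Rightarrow> 'b list \<Rightarrow> bool" where
  "reduced arev p \<longleftrightarrow> successively (\<lambda>e f. f \<noteq> arev e) p"

definition extend :: "('b \<Rightarrow> 'b) \<Rightarrow> 'b list \<Rightarrow> 'b \<Rightarrow> 'b list" where
  "extend arev p e = (if p \<noteq> [] \<and> last p = arev e then butlast p else p @ [e])"

definition reduced_concat :: "('b \<Rightarrow> 'b) \<Rightarrow> 'b list \<Rightarrow> 'b list \<Rightarrow> 'b list" where
  "reduced_concat arev p q = foldl (extend arev) p q"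

definition universal_cover ::
    "('a, 'b) pre_digraph \<Rightarrow> ('b \<Rightarrow> 'b) \<Rightarrow> 'a \<Rightarrow> ('b list, 'b list \<times> 'b) pre_digraph" where
  "universal_cover G arev v0 =
    (let V = {p. reduced arev p \<and> (\<exists>v. pre_digraph.awalk G v0 p v)} in
     \<lparr> verts = V,
       arcs = {(p, e). p \<in> V \<and> e \<in> arcs G \<and> tail G e = pre_digraph.awlast G v0 p},
       tail = fst,
       head = (\<lambda>(p, e). extend arev p e) \<rparr>)"

definition cover_rev ::
    "('a, 'b) pre_digraph \<Rightarrow> ('b \<Rightarrow> 'b) \<Rightarrow> 'a \<Rightarrow> 'b list \<times> 'b \<Rightarrow> 'b list \<times> 'b" where
  "cover_rev G arev v0 d =
    (if d \<in> arcs (universal_cover G arev v0)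
     then (extend arev (fst d) (snd d), arev (snd d)) else d)"

definition fundamental_group ::
    "('a, 'b) pre_digraph \<Rightarrow> ('b \<Rightarrow> 'b) \<Rightarrow> 'a \<Rightarrow> 'b list monoid" where
  "fundamental_group G arev v0 =
    \<lparr> carrier = {p. reduced arev p \<and> pre_digraph.awalk G v0 p v0},
      monoid.mult = reduced_concat arev,
      one = [] \<rparr>"

text \<open>Deck transformations; on vertices, \<open>g\<close> acts by \<open>reduced_concat arev g\<close>.\<close>

definition deck_arc :: "('b \<Rightarrow> 'b) \<Rightarrow> 'b list \<Rightarrow> 'b list \<times> 'b \<Rightarrow> 'b list \<times> 'b" where
  "deck_arc arev g d = (reduced_concat arev g (fst d), snd d)"


section \<open>Boundary of a tree\<close>

definition semi_geodesics :: "('w, 'd) pre_digraph \<Rightarrow> ('d \<Rightarrow> 'd) \<Rightarrow> (nat \<Rightarrow> 'd) set" where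
  "semi_geodesics T trev =
    {s. \<forall>i. s i \<in> arcs T \<and> head T (s i) = tail T (s (Suc i)) \<and> s (Suc i) \<noteq> trev (s i)}"

text \<open>
  Two semi-geodesics agree except on finitely many edges if they coincide after a finite
  initial segment has been removed from each; the two segments may differ in length.
\<close>

definition end_rel :: "('w, 'd) pre_digraph \<Rightarrow> ('d \<Rightarrow> 'd) \<Rightarrow> ((nat \<Rightarrow> 'd) \<times> (nat \<Rightarrow> 'd)) set" where
  "end_rel T trev =
    {(s, s'). s \<in> semi_geodesics T trev \<and> s' \<in> semi_geodesics T trev \<and>
              (\<exists>m n. \<forall>k. s (m + k) = s' (n + k))}"

definition boundary :: "('w, 'd) pre_digraph \<Rightarrow> ('d \<Rightarrow> 'd) \<Rightarrow> (nat \<Rightarrow> 'd) set set" where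
  "boundary T trev = semi_geodesics T trev // end_rel T trev"

definition Omega :: "('w, 'd) pre_digraph \<Rightarrow> ('d \<Rightarrow> 'd) \<Rightarrow> 'd \<Rightarrow> (nat \<Rightarrow> 'd) set set" where
  "Omega T trev d = {end_rel T trev `` {s} | s. s \<in> semi_geodesics T trev \<and> s 0 = d}"

definition boundary_topology ::
    "('w, 'd) pre_digraph \<Rightarrow> ('d \<Rightarrow> 'd) \<Rightarrow> (nat \<Rightarrow> 'd) set topology" where
  "boundary_topology T trev = topology_generated_by (Omega T trev ` arcs T)"

definition clopens :: "'x topology \<Rightarrow> 'x set set" where
  "clopens X = {A. openin X A \<and> closedin X A}"


section \<open>Distributions\<close>

text \<open>
  A distribution is defined on the clopen sets only. As functions are total, it is
  normalised to be zero on all other sets, so that the distributions form a subgroup of the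
  group of all functions under pointwise addition.
\<close>

definition distributions :: "'x topology \<Rightarrow> ('x set \<Rightarrow> 'm::ab_group_add) set" where
  "distributions X =
    {\<mu>. (\<forall>A\<in>clopens X. \<forall>B\<in>clopens X. A \<inter> B = {} \<longrightarrow> \<mu> (A \<union> B) = \<mu> A + \<mu> B) \<and>
        (\<forall>A. A \<notin> clopens X \<longrightarrow> \<mu> A = 0)}"

text \<open>The action on ends is induced by the pointwise action on the arcs of a semi-geodesic.\<close>

definition deck_end ::
    "('b \<Rightarrow> 'b) \<Rightarrow> 'b list \<Rightarrow> (nat \<Rightarrow> 'b list \<times> 'b) set \<Rightarrow> (nat \<Rightarrow> 'b list \<times> 'b) set" where
  "deck_end arev g \<xi> = (\<lambda>s. deck_arc arev g \<circ> s) ` \<xi>"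

abbreviation cover_boundary ::
    "('a, 'b) pre_digraph \<Rightarrow> ('b \<Rightarrow> 'b) \<Rightarrow> 'a \<Rightarrow> (nat \<Rightarrow> 'b list \<times> 'b) set set" where
  "cover_boundary G arev v0 \<equiv> boundary (universal_cover G arev v0) (cover_rev G arev v0)"

abbreviation cover_boundary_topology ::
    "('a, 'b) pre_digraph \<Rightarrow> ('b \<Rightarrow> 'b) \<Rightarrow> 'a \<Rightarrow> (nat \<Rightarrow> 'b list \<times> 'b) set topology" where
  "cover_boundary_topology G arev v0 \<equiv>
    boundary_topology (universal_cover G arev v0) (cover_rev G arev v0)"

definition inv_distributions ::
    "('a, 'b) pre_digraph \<Rightarrow> ('b \<Rightarrow> 'b) \<Rightarrow> 'a \<Rightarrow>
      ((nat \<Rightarrow> 'b list \<times> 'b) set set \<Rightarrow> 'm::ab_group_add) set" where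
  "inv_distributions G arev v0 =
    {\<mu> \<in> distributions (cover_boundary_topology G arev v0).
       \<forall>g\<in>carrier (fundamental_group G arev v0).
         \<forall>A\<in>clopens (cover_boundary_topology G arev v0). \<mu> (deck_end arev g ` A) = \<mu> A}"

definition inv_distributions0 ::
    "('a, 'b) pre_digraph \<Rightarrow> ('b \<Rightarrow> 'b) \<Rightarrow> 'a \<Rightarrow>
      ((nat \<Rightarrow> 'b list \<times> 'b) set set \<Rightarrow> 'm::ab_group_add) set" where
  "inv_distributions0 G arev v0 =
    {\<mu> \<in> inv_distributions G arev v0. \<mu> (cover_boundary G arev v0) = 0}"


section \<open>The construction is the universal cover with its deck group\<close>

locale rev_inv =
  fixes arev :: "'b \<Rightarrow> 'b"
  assumes inv [simp]: "arev (arev a) = a"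
begin

lemma reduced_Nil [simp]: "reduced arev []"
  by (simp add: reduced_def)

lemma reduced_snoc: "reduced arev (p @ [e]) \<longleftrightarrow> reduced arev p \<and> (p = [] \<or> last p \<noteq> arev e)"
  unfolding reduced_def successively_append_iff by auto

lemma reduced_extend: "reduced arev p \<Longrightarrow> reduced arev (extend arev p e)"
  using reduced_snoc[of "butlast p" "last p"] reduced_snoc[of p e]
  by (cases "p = []") (auto simp: extend_def)

lemma extend_extend:
  assumes "reduced arev p" shows "extend arev (extend arev p e) (arev e) = p"
proof (cases p rule: rev_cases)
  case (snoc q f)
  then show ?thesis using assms
    by (cases "f = arev e") (auto simp: extend_def reduced_snoc butlast_append)
qed (simp add: extend_def)

lemma reduced_concat_Nil [simp]: "reduced_concat arev p [] = p"
  by (simp add: reduced_concat_def)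

lemma reduced_concat_snoc [simp]:
  "reduced_concat arev p (q @ [e]) = extend arev (reduced_concat arev p q) e"
  by (simp add: reduced_concat_def)

lemma reduced_concat_Cons:
  "reduced_concat arev p (e # q) = reduced_concat arev (extend arev p e) q"
  by (simp add: reduced_concat_def)

lemma reduced_concat_reduced: "reduced arev p \<Longrightarrow> reduced arev (reduced_concat arev p q)"
  by (induction q rule: rev_induct) (auto intro: reduced_extend)

lemma reduced_concat_extend:
  assumes "reduced arev p" "reduced arev q"
  shows "reduced_concat arev p (extend arev q e) = extend arev (reduced_concat arev p q) e"
proof (cases "q \<noteq> [] \<and> last q = arev e")
  case True
  then obtain q' where q: "q = q' @ [arev e]" by (metis append_butlast_last_id)
  then have "extend arev q e = q'" by (simp add: extend_def)
  moreover have "extend arev (reduced_concat arev p q) e = reduced_concat arev p q'"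
    using extend_extend[OF reduced_concat_reduced[OF assms(1), of q'], of "arev e"] q by simp
  ultimately show ?thesis by simp
next
  case False
  then have "extend arev q e = q @ [e]" by (auto simp: extend_def)
  then show ?thesis by simp
qed

lemma reduced_concat_assoc:
  assumes "reduced arev p" "reduced arev q"
  shows "reduced_concat arev (reduced_concat arev p q) r
       = reduced_concat arev p (reduced_concat arev q r)"
  by (induction r rule: rev_induct)
     (auto simp: reduced_concat_extend reduced_concat_reduced assms)

lemma Nil_reduced_concat: "reduced arev p \<Longrightarrow> reduced_concat arev [] p = p"
  by (induction p rule: rev_induct) (auto simp: reduced_snoc extend_def)

lemma reduced_concat_inverse:
  "reduced arev p \<Longrightarrow> reduced_concat arev (reduced_concat arev p q) (rev (map arev q)) = p"
  by (induction q arbitrary: p)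
     (auto simp: reduced_concat_Cons reduced_extend extend_extend)

lemma reduced_inverse: "reduced arev p \<Longrightarrow> reduced arev (rev (map arev p))"
proof -
  have *: "(\<lambda>e f. arev e \<noteq> arev (arev f)) = (\<lambda>e f. f \<noteq> arev e)"
    by (auto simp: fun_eq_iff)
  show "reduced arev p \<Longrightarrow> reduced arev (rev (map arev p))"
    unfolding reduced_def successively_rev successively_map * .
qed

lemma inverse_inverse: "rev (map arev (rev (map arev p))) = p"
  by (simp add: rev_map comp_def)

end

locale based_graph = bidirected_digraph G arev
    for G :: "('a, 'b) pre_digraph" and arev :: "'b \<Rightarrow> 'b" +
  fixes v0 :: 'a
  assumes v0: "v0 \<in> verts G" and conn: "connected G"
begin

sublocale rev_inv arev
  by unfold_locales simp

abbreviation "\<Delta> \<equiv> universal_cover G arev v0"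
abbreviation "\<Delta>_rev \<equiv> cover_rev G arev v0"
abbreviation "\<Gamma> \<equiv> fundamental_group G arev v0"
abbreviation "proj \<equiv> awlast v0"

lemma cover_verts: "p \<in> verts \<Delta> \<longleftrightarrow> reduced arev p \<and> awalk v0 p (proj p)"
  by (auto simp: universal_cover_def Let_def awlast_if_cas awalk_def)

lemma cover_arcs: "(p, e) \<in> arcs \<Delta> \<longleftrightarrow> p \<in> verts \<Delta> \<and> e \<in> arcs G \<and> tail G e = proj p"
  by (auto simp: universal_cover_def Let_def)

lemma cover_tail [simp]: "tail \<Delta> (p, e) = p"
  and cover_head [simp]: "head \<Delta> (p, e) = extend arev p e"
  by (auto simp: universal_cover_def Let_def)

lemma awalk_proj: "awalk v0 p v \<Longrightarrow> proj p = v"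
  by auto

lemma awalk_extend:
  assumes "awalk v0 p u" "e \<in> arcs G" "tail G e = u"
  shows "awalk v0 (extend arev p e) (head G e)"
proof (cases "p \<noteq> [] \<and> last p = arev e")
  case True
  then obtain q where q: "p = q @ [arev e]" by (metis append_butlast_last_id)
  then show ?thesis using assms by (auto simp: extend_def awalk_Cons_iff)
next
  case False
  then have "extend arev p e = p @ [e]" by (auto simp: extend_def)
  then show ?thesis using assms by (auto simp: awalk_Cons_iff awalk_Nil_iff)
qed

lemma awalk_reduced_concat:
  "awalk v0 p u \<Longrightarrow> awalk u q w \<Longrightarrow> awalk v0 (reduced_concat arev p q) w"
proof (induction q arbitrary: p u)
  case (Cons e q)
  then have e: "e \<in> arcs G" "tail G e = u" "awalk (head G e) q w"
    by (auto simp: awalk_Cons_iff)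
  show ?case unfolding reduced_concat_Cons
    by (rule Cons.IH[OF awalk_extend[OF Cons.prems(1) e(1,2)] e(3)])
qed (auto simp: awalk_Nil_iff)

lemma awalk_inverse: "awalk u q w \<Longrightarrow> awalk w (rev (map arev q)) u"
proof (induction q arbitrary: u)
  case (Cons e q)
  then have e: "e \<in> arcs G" "tail G e = u" "awalk w (rev (map arev q)) (head G e)"
    by (auto simp: awalk_Cons_iff)
  have "awalk (head G e) [arev e] u"
    using e by (auto simp: awalk_Cons_iff awalk_Nil_iff)
  with e(3) show ?case by simp
qed (simp add: awalk_Nil_iff)

lemma extend_in_cover:
  assumes "p \<in> verts \<Delta>" "e \<in> arcs G" "tail G e = proj p"
  shows "extend arev p e \<in> verts \<Delta>" "proj (extend arev p e) = head G e"
  using assms awalk_extend[of p "proj p" e] awalk_proj by (auto simp: cover_verts reduced_extend)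

theorem cover_bidirected: "bidirected_digraph \<Delta> \<Delta>_rev"
proof -
  interpret D: wf_digraph \<Delta>
    by unfold_locales (auto simp: cover_arcs extend_in_cover)
  have in_arcs: "\<Delta>_rev d \<in> arcs \<Delta>" if "d \<in> arcs \<Delta>" for d
    using that by (cases d) (auto simp: cover_rev_def cover_arcs extend_in_cover)
  show ?thesis
  proof (rule D.bidirected_digraphI)
    fix d assume d: "d \<in> arcs \<Delta>"
    obtain p e where [simp]: "d = (p, e)" by (cases d)
    show "\<Delta>_rev d \<noteq> d" using d arev_neq by (auto simp: cover_rev_def cover_arcs)
    show "\<Delta>_rev (\<Delta>_rev d) = d" using d in_arcs[OF d]
      by (auto simp: cover_rev_def cover_arcs cover_verts extend_extend)
    show "tail \<Delta> (\<Delta>_rev d) = head \<Delta> d" using d by (auto simp: cover_rev_def)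
  qed (auto simp: cover_rev_def)
qed

theorem cover_covering:
  shows "proj ` verts \<Delta> = verts G"
    and "d \<in> arcs \<Delta> \<Longrightarrow> snd d \<in> arcs G \<and> tail G (snd d) = proj (tail \<Delta> d) \<and>
           head G (snd d) = proj (head \<Delta> d) \<and> snd (\<Delta>_rev d) = arev (snd d)"
    and "p \<in> verts \<Delta> \<Longrightarrow> bij_betw snd (out_arcs \<Delta> p) (out_arcs G (proj p))"
proof -
  show "proj ` verts \<Delta> = verts G"
  proof (intro equalityI subsetI)
    fix v assume "v \<in> verts G"
    have sym: "symmetric G"
      unfolding symmetric_conv by (metis arev_in_arcs tail_arev head_arev)
    from conn have "v0 \<rightarrow>\<^sup>*\<^bsub>mk_symmetric G\<^esub> v"
      using v0 \<open>v \<in> verts G\<close> by (auto simp: connected_def strongly_connected_def)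
    then have "v0 \<rightarrow>\<^sup>*\<^bsub>G\<^esub> v"
      by (simp only: reachable_mk_symmetric_eq[OF sym])
    then obtain q where "awalk v0 q v" by (auto simp: reachable_awalk)
    then have "awalk v0 (reduced_concat arev [] q) v"
      using v0 by (intro awalk_reduced_concat) (auto simp: awalk_Nil_iff)
    then show "v \<in> proj ` verts \<Delta>"
      by (intro image_eqI[of _ _ "reduced_concat arev [] q"])
         (auto simp: cover_verts reduced_concat_reduced awalk_proj)
  qed (auto simp: cover_verts dest: awalk_last_in_verts)
  show "d \<in> arcs \<Delta> \<Longrightarrow> snd d \<in> arcs G \<and> tail G (snd d) = proj (tail \<Delta> d) \<and>
           head G (snd d) = proj (head \<Delta> d) \<and> snd (\<Delta>_rev d) = arev (snd d)"
    by (cases d) (auto simp: cover_arcs cover_rev_def extend_in_cover)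
  show "p \<in> verts \<Delta> \<Longrightarrow> bij_betw snd (out_arcs \<Delta> p) (out_arcs G (proj p))"
    by (rule bij_betw_byWitness[where f' = "Pair p"]) (auto simp: cover_arcs)
qed

text \<open>Tree property: connected, and every closed walk without backtracking is trivial.\<close>

lemma cover_awalk:
  "pre_digraph.awalk \<Delta> p ds q \<Longrightarrow>
     q = reduced_concat arev p (map snd ds) \<and> awalk (proj p) (map snd ds) (proj q)"
proof (induction ds arbitrary: p)
  case Nil
  then show ?case
    by (auto simp: pre_digraph.awalk_def pre_digraph.cas.simps cover_verts awalk_Nil_iff
      intro: awlast_in_verts)
next
  case (Cons d ds)
  obtain p' e where d: "d = (p', e)" by (cases d)
  from Cons.prems d have *: "p' = p" "(p, e) \<in> arcs \<Delta>" "set ds \<subseteq> arcs \<Delta>"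
    "pre_digraph.cas \<Delta> (extend arev p e) ds q"
    by (auto simp: pre_digraph.awalk_def pre_digraph.cas.simps)
  then have "pre_digraph.awalk \<Delta> (extend arev p e) ds q"
    by (auto simp: pre_digraph.awalk_def cover_arcs extend_in_cover)
  from Cons.IH[OF this] * d show ?case
    by (auto simp: reduced_concat_Cons awalk_Cons_iff cover_arcs extend_in_cover)
qed

lemma cover_reachable:
  assumes "p \<in> verts \<Delta>" "awalk (proj p) q v"
  shows "p \<rightarrow>\<^sup>*\<^bsub>\<Delta>\<^esub> reduced_concat arev p q"
  using assms
proof (induction q arbitrary: p)
  case Nil
  then show ?case by (simp add: reachable_def rtrancl_on_refl)
next
  case (Cons e q)
  interpret D: bidirected_digraph \<Delta> \<Delta>_rev by (rule cover_bidirected)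
  from Cons.prems have e: "e \<in> arcs G" "tail G e = proj p" "awalk (head G e) q v"
    by (auto simp: awalk_Cons_iff)
  then have "(p, e) \<in> arcs \<Delta>" using Cons.prems by (auto simp: cover_arcs)
  then have "p \<rightarrow>\<^bsub>\<Delta>\<^esub> extend arev p e"
    by (force simp: arcs_ends_conv)
  moreover have "extend arev p e \<rightarrow>\<^sup>*\<^bsub>\<Delta>\<^esub> reduced_concat arev (extend arev p e) q"
    using Cons.IH[of "extend arev p e"] e Cons.prems(1) extend_in_cover by auto
  ultimately show ?case
    unfolding reduced_concat_Cons by (rule D.adj_reachable_trans)
qed

theorem cover_tree:
  shows "connected \<Delta>"
    and "pre_digraph.awalk \<Delta> p ds p \<Longrightarrow> reduced \<Delta>_rev ds \<Longrightarrow> ds = []"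
proof -
  interpret D: bidirected_digraph \<Delta> \<Delta>_rev by (rule cover_bidirected)
  have base: "[] \<in> verts \<Delta>" by (simp add: cover_verts awalk_Nil_iff v0)
  have "p \<rightarrow>\<^sup>*\<^bsub>\<Delta>\<^esub> q" if pq: "p \<in> verts \<Delta>" "q \<in> verts \<Delta>" for p q
  proof -
    have "awalk (proj p) (rev (map arev p)) v0"
      using pq by (auto simp: cover_verts intro!: awalk_inverse)
    then have "p \<rightarrow>\<^sup>*\<^bsub>\<Delta>\<^esub> reduced_concat arev p (rev (map arev p))"
      using pq cover_reachable by blast
    moreover have "reduced_concat arev p (rev (map arev p)) = []"
      using reduced_concat_inverse[of "[]" p] Nil_reduced_concat pq by (auto simp: cover_verts)
    moreover have "[] \<rightarrow>\<^sup>*\<^bsub>\<Delta>\<^esub> q"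
      using cover_reachable[of "[]" q "proj q"] base pq Nil_reduced_concat by (auto simp: cover_verts)
    ultimately show ?thesis using D.reachable_trans by metis
  qed
  then have "p \<rightarrow>\<^sup>*\<^bsub>mk_symmetric \<Delta>\<^esub> q" if "p \<in> verts \<Delta>" "q \<in> verts \<Delta>" for p q
    using that by (intro D.reachable_mk_symmetricI) auto
  then show "connected \<Delta>" using base by (auto simp: connected_def strongly_connected_def)
next
  assume w: "pre_digraph.awalk \<Delta> p ds p" and r: "reduced \<Delta>_rev ds"
  have p: "reduced arev p" using w by (auto simp: pre_digraph.awalk_def cover_verts)
  have "reduced arev (map snd ds)"
    unfolding reduced_def successively_map
  proof -
    have "pre_digraph.cas \<Delta> p ds q \<Longrightarrow> set ds \<subseteq> arcs \<Delta> \<Longrightarrow> successively (\<lambda>e f. f \<noteq> \<Delta>_rev e) ds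
      \<Longrightarrow> successively (\<lambda>x y. snd y \<noteq> arev (snd x)) ds" for p q
      by (induction ds arbitrary: p rule: induct_list012)
         (auto simp: pre_digraph.cas.simps cover_rev_def)
    then show "successively (\<lambda>x y. snd y \<noteq> arev (snd x)) ds"
      using w r by (auto simp: pre_digraph.awalk_def reduced_def)
  qed
  moreover have "p = reduced_concat arev p (map snd ds)" using cover_awalk[OF w] by simp
  then have "reduced_concat arev (rev (map arev p)) p
      = reduced_concat arev (reduced_concat arev (rev (map arev p)) p) (map snd ds)"
    using reduced_concat_assoc[OF reduced_inverse[OF p] p] by metis
  moreover have "reduced_concat arev (rev (map arev p)) p = []"
    using reduced_concat_inverse[of "[]" "rev (map arev p)"] p
    by (metis inverse_inverse Nil_reduced_concat reduced_Nil reduced_inverse)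
  ultimately show "ds = []" using Nil_reduced_concat by auto
qed

theorem fundamental_group_group: "group \<Gamma>"
proof (rule groupI)
  fix x y z
  assume x: "x \<in> carrier \<Gamma>" and y: "y \<in> carrier \<Gamma>" and z: "z \<in> carrier \<Gamma>"
  show "x \<otimes>\<^bsub>\<Gamma>\<^esub> y \<in> carrier \<Gamma>" using x y
    by (auto simp: fundamental_group_def reduced_concat_reduced intro: awalk_reduced_concat)
  show "x \<otimes>\<^bsub>\<Gamma>\<^esub> y \<otimes>\<^bsub>\<Gamma>\<^esub> z = x \<otimes>\<^bsub>\<Gamma>\<^esub> (y \<otimes>\<^bsub>\<Gamma>\<^esub> z)" using x y
    by (auto simp: fundamental_group_def reduced_concat_assoc)
next
  show "\<one>\<^bsub>\<Gamma>\<^esub> \<in> carrier \<Gamma>" by (auto simp: fundamental_group_def awalk_Nil_iff v0)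
next
  fix x assume x: "x \<in> carrier \<Gamma>"
  show "\<one>\<^bsub>\<Gamma>\<^esub> \<otimes>\<^bsub>\<Gamma>\<^esub> x = x" using x
    by (auto simp: fundamental_group_def Nil_reduced_concat)
  have "reduced_concat arev (rev (map arev x)) x = []"
    using reduced_concat_inverse[of "[]" "rev (map arev x)"] x
    by (auto simp: fundamental_group_def)
       (metis inverse_inverse Nil_reduced_concat reduced_Nil reduced_inverse)
  then show "\<exists>y\<in>carrier \<Gamma>. y \<otimes>\<^bsub>\<Gamma>\<^esub> x = \<one>\<^bsub>\<Gamma>\<^esub>" using x
    by (intro bexI[of _ "rev (map arev x)"])
       (auto simp: fundamental_group_def reduced_inverse intro: awalk_inverse)
qed

text \<open>The fundamental group acts by automorphisms of \<open>\<Delta>\<close> over \<open>G\<close>, with quotient \<open>G\<close>.\<close>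

theorem deck_action:
  assumes g: "g \<in> carrier \<Gamma>"
  shows "p \<in> verts \<Delta> \<Longrightarrow> reduced_concat arev g p \<in> verts \<Delta> \<and> proj (reduced_concat arev g p) = proj p"
    and "p \<in> verts \<Delta> \<Longrightarrow> reduced_concat arev \<one>\<^bsub>\<Gamma>\<^esub> p = p"
    and "h \<in> carrier \<Gamma> \<Longrightarrow> reduced_concat arev (g \<otimes>\<^bsub>\<Gamma>\<^esub> h) p
           = reduced_concat arev g (reduced_concat arev h p)"
    and "d \<in> arcs \<Delta> \<Longrightarrow> deck_arc arev g d \<in> arcs \<Delta> \<and>
           tail \<Delta> (deck_arc arev g d) = reduced_concat arev g (tail \<Delta> d) \<and>
           head \<Delta> (deck_arc arev g d) = reduced_concat arev g (head \<Delta> d) \<and>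
           \<Delta>_rev (deck_arc arev g d) = deck_arc arev g (\<Delta>_rev d)"
proof -
  have gr: "reduced arev g" "awalk v0 g v0" using g by (auto simp: fundamental_group_def)
  have 1: "reduced_concat arev g p \<in> verts \<Delta> \<and> proj (reduced_concat arev g p) = proj p"
    if "p \<in> verts \<Delta>" for p
    using that gr awalk_reduced_concat[of g v0 p "proj p"] awalk_proj
    by (auto simp: cover_verts reduced_concat_reduced)
  show "p \<in> verts \<Delta> \<Longrightarrow> reduced_concat arev g p \<in> verts \<Delta> \<and> proj (reduced_concat arev g p) = proj p"
    by (rule 1)
  show "p \<in> verts \<Delta> \<Longrightarrow> reduced_concat arev \<one>\<^bsub>\<Gamma>\<^esub> p = p"
    by (auto simp: fundamental_group_def cover_verts Nil_reduced_concat)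
  show "h \<in> carrier \<Gamma> \<Longrightarrow> reduced_concat arev (g \<otimes>\<^bsub>\<Gamma>\<^esub> h) p
           = reduced_concat arev g (reduced_concat arev h p)"
    using g by (auto simp: fundamental_group_def reduced_concat_assoc)
  assume d: "d \<in> arcs \<Delta>"
  obtain p e where de: "d = (p, e)" by (cases d)
  have pe: "p \<in> verts \<Delta>" "e \<in> arcs G" "tail G e = proj p" using d de by (auto simp: cover_arcs)
  have a: "deck_arc arev g d \<in> arcs \<Delta>"
    using pe 1[of p] by (auto simp: de deck_arc_def cover_arcs)
  then show "deck_arc arev g d \<in> arcs \<Delta> \<and>
           tail \<Delta> (deck_arc arev g d) = reduced_concat arev g (tail \<Delta> d) \<and>
           head \<Delta> (deck_arc arev g d) = reduced_concat arev g (head \<Delta> d) \<and>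
           \<Delta>_rev (deck_arc arev g d) = deck_arc arev g (\<Delta>_rev d)"
    using d pe gr by (auto simp: de deck_arc_def cover_rev_def reduced_concat_extend cover_verts)
qed

theorem deck_orbits:
  assumes "p \<in> verts \<Delta>" "q \<in> verts \<Delta>"
  shows "proj p = proj q \<longleftrightarrow> (\<exists>g\<in>carrier \<Gamma>. reduced_concat arev g p = q)"
proof
  assume eq: "proj p = proj q"
  let ?g = "reduced_concat arev q (rev (map arev p))"
  have pr: "reduced arev p" "reduced arev q" "awalk v0 p (proj p)" "awalk v0 q (proj p)"
    using assms eq by (auto simp: cover_verts)
  have "?g \<in> carrier \<Gamma>"
    using pr awalk_reduced_concat[OF pr(4) awalk_inverse[OF pr(3)]]
    by (auto simp: fundamental_group_def reduced_concat_reduced)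
  moreover have "reduced_concat arev ?g p = q"
    using reduced_concat_inverse[OF pr(2), of "rev (map arev p)"] by (simp only: inverse_inverse)
  ultimately show "\<exists>g\<in>carrier \<Gamma>. reduced_concat arev g p = q" by blast
qed (use assms deck_action(1) in metis)

end

end

theory Submission
  imports Defs
begin

text \<open>
  Write \<open>M\<close> for the total mass \<open>\<mu>(\<partial>\<Delta>)\<close> of a \<open>\<Gamma>\<close>-invariant distribution \<open>\<mu>\<close>. The claim is that
  \<open>\<chi>(G) \<sqdot> M = 0\<close>; then \<open>M = 0\<close> because the group has no \<open>\<chi>(G)\<close>-torsion.

  Two arcs of \<open>\<Delta>\<close> over the same arc \<open>e\<close> of \<open>G\<close> are translates of each other under \<open>\<Gamma>\<close>, so
  \<open>\<mu>(\<Omega>\<^sub>\<delta>)\<close> is a function \<open>f(e)\<close> of the arc \<open>e\<close> below \<open>\<delta>\<close> (\<open>inv_distribution_Omega\<close>). Looking at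
  \<open>\<partial>\<Delta>\<close> from a vertex of \<open>\<Delta>\<close>, every end leaves through exactly one of the arcs issuing there; and
  cutting \<open>\<Delta>\<close> at an edge splits the ends into the two sides of the cut
  (\<open>ends_eq_UN_Omega\<close>, \<open>Omega_disjoint\<close>, \<open>Omega_trev\<close>). By additivity, \<open>f\<close> sums to \<open>M\<close> over
  the arcs issuing from any vertex of \<open>G\<close>, and \<open>f(e) + f(\<bar>e) = M\<close> for any arc \<open>e\<close> with reverse
  \<open>\<bar>e\<close>. Adding up \<open>f\<close> over all arcs of \<open>G\<close>, grouped by initial vertex and grouped by geometric
  edge, therefore gives \<open>n\<^sub>0 \<sqdot> M = n\<^sub>1 \<sqdot> M\<close> (\<open>euler_char_mult_eq_0\<close>).

  Both decompositions of \<open>\<partial>\<Delta>\<close> rest on one property of a tree: each end is represented by exactly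
  one semi-geodesic starting at a given vertex (\<open>ray_from_vertex\<close>, \<open>ray_unique\<close>).
\<close>

section \<open>Ends of a tree seen from a vertex\<close>

lemma (in based_graph) awalk_between:
  assumes "u \<in> verts G" "v \<in> verts G"
  obtains q where "awalk u q v"
proof -
  have sym: "symmetric G"
    unfolding symmetric_conv by (metis arev_in_arcs tail_arev head_arev)
  have "u \<rightarrow>\<^sup>*\<^bsub>mk_symmetric G\<^esub> v"
    using conn assms by (auto simp: connected_def strongly_connected_def)
  then show thesis
    using that by (auto simp: reachable_mk_symmetric_eq[OF sym] reachable_awalk)
qed

text \<open>
  Trees are built on based graphs because connectedness and the calculus of reduced walks and
  their inverses then carry over; the universal cover is rooted at the empty walk.
\<close>

locale edge_tree = based_graph T trev root
    for T :: "('w, 'd) pre_digraph" and trev :: "'d \<Rightarrow> 'd" and root :: 'w +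
  assumes closed_reduced_awalk: "awalk p ds p \<Longrightarrow> reduced trev ds \<Longrightarrow> ds = []"
begin

text \<open>
  After common final arcs have been removed, following the first walk and then the second one
  backwards is a closed reduced walk, hence empty.
\<close>

lemma reduced_awalk_unique:
  assumes "awalk p ds q" "awalk p ds' q" "reduced trev ds" "reduced trev ds'"
  shows "ds = ds'"
  using assms
proof (induction ds arbitrary: ds' q rule: rev_induct)
  case Nil
  then have "p = q" by (simp add: awalk_Nil_iff)
  with Nil show ?case using closed_reduced_awalk[of p ds'] by simp
next
  case (snoc a ds)
  show ?case
  proof (cases ds' rule: rev_cases)
    case Nil
    then have "p = q" using snoc.prems by (simp add: awalk_Nil_iff)
    with snoc.prems show ?thesis using closed_reduced_awalk[of p "ds @ [a]"] by simp
  next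
    case (snoc ds'' b)
    note ds' = this
    show ?thesis
    proof (cases "a = b")
      case True
      have "awalk p ds (tail T a)" "awalk p ds'' (tail T a)"
        using snoc.prems True by (auto simp: ds' awalk_Cons_iff)
      moreover have "reduced trev ds" "reduced trev ds''"
        using snoc.prems by (auto simp: ds' reduced_snoc)
      ultimately show ?thesis using snoc.IH[of "tail T a" ds''] True ds' by simp
    next
      case False
      let ?loop = "(ds @ [a]) @ rev (map trev ds')"
      have "awalk p ?loop p"
        using snoc.prems awalk_inverse by (blast intro: awalk_appendI)
      \<comment> \<open>At the turning point \<open>a\<close> is followed by \<open>trev b\<close>, which is no backtracking.\<close>
      moreover have "trev b \<noteq> trev a" using False inv by metis
      then have "reduced trev ?loop"
        using snoc.prems(3) reduced_inverse[OF snoc.prems(4)]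
        unfolding reduced_def successively_append_iff by (auto simp: ds')
      ultimately show ?thesis using closed_reduced_awalk by blast
    qed
  qed
qed

abbreviation "rays \<equiv> semi_geodesics T trev"
abbreviation "ends \<equiv> boundary T trev"
abbreviation "same_end \<equiv> end_rel T trev"

lemma ray_arc: "s \<in> rays \<Longrightarrow> s i \<in> arcs T"
  by (simp add: semi_geodesics_def)

lemma ray_segment:
  assumes "s \<in> rays"
  shows "awalk (tail T (s 0)) (map s [0..<n]) (tail T (s n))"
    and "reduced trev (map s [0..<n])"
proof -
  note s = assms[unfolded semi_geodesics_def, simplified, rule_format]
  show "awalk (tail T (s 0)) (map s [0..<n]) (tail T (s n))"
  proof (induction n)
    case (Suc n)
    have "awalk (tail T (s n)) [s n] (tail T (s (Suc n)))"
      using s[of n] s[of "Suc n"] by (auto simp: awalk_Cons_iff awalk_Nil_iff)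
    with Suc show ?case by (auto intro: awalk_appendI)
  qed (use s in \<open>auto simp: awalk_Nil_iff\<close>)
  show "reduced trev (map s [0..<n])"
  proof (induction n)
    case (Suc n)
    have "s n \<noteq> trev (s (n - 1)) \<or> n = 0"
      using s[of "n - 1"] by (cases n) auto
    then have "last (map s [0..<n]) \<noteq> trev (s n) \<or> n = 0"
      by (cases n) (auto dest: arg_cong[of _ _ trev])
    with Suc show ?case by (auto simp: reduced_snoc)
  qed simp
qed

text \<open>
  Where the two rays begin to coincide, the initial segments before that point are reduced walks
  with the same end points. So the segments are equal, and in particular the shift between the two
  rays is zero.
\<close>

lemma ray_unique:
  assumes "(s, s') \<in> same_end" "tail T (s 0) = tail T (s' 0)"
  shows "s = s'"
proof -
  obtain m n where s: "s \<in> rays" "s' \<in> rays" and mn: "\<And>k. s (m + k) = s' (n + k)"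
    using assms(1) by (auto simp: end_rel_def)
  have "tail T (s m) = tail T (s' n)" using mn[of 0] by simp
  then have eq: "map s [0..<m] = map s' [0..<n]"
    using ray_segment[OF s(1), of m] ray_segment[OF s(2), of n] assms(2)
    by (metis reduced_awalk_unique)
  then have "m = n" by (metis length_map length_upt diff_zero)
  show ?thesis
  proof
    fix i show "s i = s' i"
    proof (cases "i < m")
      case True
      then show ?thesis using eq \<open>m = n\<close> by simp
    next
      case False
      then show ?thesis using mn[of "i - m"] \<open>m = n\<close> by simp
    qed
  qed
qed

lemma equiv_same_end: "equiv rays same_end"
proof (rule equivI)
  show "refl_on rays same_end"
    by (auto simp: refl_on_def end_rel_def)
  show "sym same_end"
    by (auto simp: sym_def end_rel_def) metis
  show "trans same_end"
  proof (rule transI)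
    fix s s' s'' assume "(s, s') \<in> same_end" "(s', s'') \<in> same_end"
    then obtain m n m' n' where rays: "s \<in> rays" "s'' \<in> rays"
      and eq: "\<And>k. s (m + k) = s' (n + k)" "\<And>k. s' (m' + k) = s'' (n' + k)"
      by (auto simp: end_rel_def)
    have "s ((m + m') + k) = s'' ((n' + n) + k)" for k
      using eq(1)[of "m' + k"] eq(2)[of "n + k"] by (simp add: ac_simps)
    with rays show "(s, s'') \<in> same_end" by (auto simp: end_rel_def)
  qed
qed (auto simp: end_rel_def)

lemma ray_tl:
  assumes "s \<in> rays"
  shows "s \<circ> Suc \<in> rays" "(s, s \<circ> Suc) \<in> same_end"
proof -
  show 1: "s \<circ> Suc \<in> rays" using assms by (simp add: semi_geodesics_def)
  have "s (1 + k) = (s \<circ> Suc) (0 + k)" for k by simp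
  then show "(s, s \<circ> Suc) \<in> same_end" using 1 assms unfolding end_rel_def by blast
qed

lemma ray_Cons:
  assumes "s \<in> rays" "d \<in> arcs T" "head T d = tail T (s 0)" "s 0 \<noteq> trev d"
  shows "case_nat d s \<in> rays" "(s, case_nat d s) \<in> same_end"
proof -
  show 1: "case_nat d s \<in> rays"
    using assms by (auto simp: semi_geodesics_def split: nat.split)
  have "s (0 + k) = case_nat d s (1 + k)" for k by simp
  then show "(s, case_nat d s) \<in> same_end" using 1 assms(1) unfolding end_rel_def by blast
qed

text \<open>
  The initial vertex of a ray can be moved across one arc without changing the end: if the ray
  begins with that arc, drop it, and otherwise put the reverse arc in front. Connectedness of the
  tree then gives every vertex.
\<close>

lemma ray_from_vertex:
  assumes "s \<in> rays" "p \<in> verts T"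
  obtains s' where "(s, s') \<in> same_end" "tail T (s' 0) = p"
proof -
  have move: "\<exists>s'. (s, s') \<in> same_end \<and> tail T (s' 0) = p"
    if "awalk q ds p" "s \<in> rays" "tail T (s 0) = q" for q ds s
    using that
  proof (induction ds arbitrary: q s)
    case Nil
    then show ?case using equiv_same_end by (auto simp: awalk_Nil_iff dest: equivE refl_onD)
  next
    case (Cons d ds)
    have d: "d \<in> arcs T" "tail T d = q" "awalk (head T d) ds p"
      using Cons.prems(1) by (auto simp: awalk_Cons_iff)
    have "\<exists>s'. (s, s') \<in> same_end \<and> tail T (s' 0) = head T d"
    proof (cases "s 0 = d")
      case True
      have "tail T ((s \<circ> Suc) 0) = head T d"
        using Cons.prems(2) True by (auto simp: semi_geodesics_def)
      then show ?thesis using ray_tl[OF Cons.prems(2)] by blast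
    next
      case False
      then show ?thesis
        using ray_Cons[of s "trev d"] Cons.prems d
        by (intro exI[of _ "case_nat (trev d) s"]) auto
    qed
    then obtain s' where s': "(s, s') \<in> same_end" "tail T (s' 0) = head T d" by blast
    then have "s' \<in> rays" by (simp add: end_rel_def)
    then obtain s'' where "(s', s'') \<in> same_end" "tail T (s'' 0) = p"
      using Cons.IH d(3) s'(2) by blast
    moreover have "trans same_end" using equiv_same_end by (rule equivE)
    ultimately show ?case using s'(1) by (blast dest: transD)
  qed
  obtain ds where "awalk (tail T (s 0)) ds p"
    using awalk_between[of "tail T (s 0)" p] assms ray_arc[of s 0] by auto
  then show thesis using move[OF _ assms(1) refl] that by blast
qed

lemma mem_Omega: "\<xi> \<in> Omega T trev d \<longleftrightarrow> (\<exists>s. s \<in> rays \<and> s 0 = d \<and> \<xi> = same_end `` {s})"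
  by (auto simp: Omega_def)

lemma Omega_subset: "Omega T trev d \<subseteq> ends"
  by (auto simp: mem_Omega boundary_def intro: quotientI)

lemma ends_eq_UN_Omega:
  assumes "p \<in> verts T"
  shows "ends = (\<Union>d\<in>out_arcs T p. Omega T trev d)"
proof (intro equalityI subsetI)
  fix \<xi> assume "\<xi> \<in> ends"
  then obtain s where s: "s \<in> rays" "\<xi> = same_end `` {s}"
    by (auto simp: boundary_def elim: quotientE)
  obtain s' where s': "(s, s') \<in> same_end" "tail T (s' 0) = p"
    using ray_from_vertex[OF s(1) assms] .
  have "\<xi> = same_end `` {s'}" "s' \<in> rays"
    using s s'(1) equiv_class_eq[OF equiv_same_end] by (auto simp: end_rel_def)
  then show "\<xi> \<in> (\<Union>d\<in>out_arcs T p. Omega T trev d)"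
    using s'(2) ray_arc by (auto simp: mem_Omega)
qed (use Omega_subset in blast)

lemma Omega_disjoint:
  assumes "tail T d = tail T d'" "d \<noteq> d'"
  shows "Omega T trev d \<inter> Omega T trev d' = {}"
proof (rule ccontr)
  assume "\<not> ?thesis"
  then obtain \<xi> where "\<xi> \<in> Omega T trev d" "\<xi> \<in> Omega T trev d'" by blast
  then obtain s s' where s: "s \<in> rays" "s' \<in> rays" "s 0 = d" "s' 0 = d'"
    "same_end `` {s} = same_end `` {s'}"
    unfolding mem_Omega by metis
  then have "(s, s') \<in> same_end" using eq_equiv_class[OF _ equiv_same_end] by blast
  then show False using ray_unique[of s s'] s assms by auto
qed

text \<open>
  If the ray from \<open>tail T d\<close> to an end does not begin with \<open>d\<close>, then putting \<open>trev d\<close> in front of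
  it gives a ray to the same end. Conversely, a ray that begins with \<open>trev d\<close> continues from
  \<open>tail T d\<close> by an arc different from \<open>d\<close>, and no other ray from \<open>tail T d\<close> has the same end.
\<close>

lemma Omega_trev:
  assumes "d \<in> arcs T"
  shows "Omega T trev (trev d) = ends - Omega T trev d"
proof (intro equalityI subsetI)
  fix \<xi> assume \<xi>: "\<xi> \<in> Omega T trev (trev d)"
  then obtain s where s: "s \<in> rays" "s 0 = trev d" "\<xi> = same_end `` {s}"
    by (auto simp: mem_Omega)
  have "\<xi> = same_end `` {s \<circ> Suc}"
    using s(3) equiv_class_eq[OF equiv_same_end ray_tl(2)[OF s(1)]] by simp
  moreover have "tail T (s 1) = tail T d" "s 1 \<noteq> d"
    using s(1,2) assms by (auto simp: semi_geodesics_def dest!: spec[of _ 0])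
  moreover have "\<xi> \<in> Omega T trev (s 1)"
    unfolding mem_Omega using calculation(1) ray_tl(1)[OF s(1)]
    by (intro exI[of _ "s \<circ> Suc"]) simp
  ultimately have "\<xi> \<notin> Omega T trev d"
    using Omega_disjoint[of "s 1" d] by blast
  then show "\<xi> \<in> ends - Omega T trev d" using \<xi> Omega_subset by blast
next
  fix \<xi> assume \<xi>: "\<xi> \<in> ends - Omega T trev d"
  moreover have "tail T d \<in> verts T" using assms by simp
  ultimately obtain d' where d': "d' \<in> out_arcs T (tail T d)" "\<xi> \<in> Omega T trev d'"
    using ends_eq_UN_Omega by blast
  then obtain s where s: "s \<in> rays" "s 0 = d'" "\<xi> = same_end `` {s}"
    by (auto simp: mem_Omega)
  have "d' \<noteq> d" using d' \<xi> by blast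
  then have "case_nat (trev d) s \<in> rays" "(s, case_nat (trev d) s) \<in> same_end"
    using ray_Cons[of s "trev d"] s d'(1) assms by auto
  then show "\<xi> \<in> Omega T trev (trev d)"
    using s(3) equiv_class_eq[OF equiv_same_end] by (auto simp: mem_Omega)
qed

lemma topspace_ends: "topspace (boundary_topology T trev) = ends"
proof -
  have "ends = (\<Union>d\<in>arcs T. Omega T trev d)"
    using ends_eq_UN_Omega[OF v0] Omega_subset by fastforce
  then show ?thesis by (simp add: boundary_topology_def)
qed

text \<open>The complement of a basic open set is the basic open set of the reverse arc.\<close>

lemma Omega_clopen:
  assumes "d \<in> arcs T"
  shows "Omega T trev d \<in> clopens (boundary_topology T trev)"
proof -
  have "openin (boundary_topology T trev) (Omega T trev d')" if "d' \<in> arcs T" for d'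
    using that by (auto simp: boundary_topology_def intro: topology_generated_by_Basis)
  moreover from this have "openin (boundary_topology T trev) (ends - Omega T trev d)"
    using assms by (simp flip: Omega_trev)
  ultimately show ?thesis
    using assms Omega_subset by (auto simp: clopens_def closedin_def topspace_ends)
qed

end


section \<open>Finite additivity\<close>

lemma clopens_empty: "{} \<in> clopens X"
  by (simp add: clopens_def)

lemma clopens_Un: "A \<in> clopens X \<Longrightarrow> B \<in> clopens X \<Longrightarrow> A \<union> B \<in> clopens X"
  by (auto simp: clopens_def)

lemma clopens_UN:
  "finite I \<Longrightarrow> (\<And>i. i \<in> I \<Longrightarrow> A i \<in> clopens X) \<Longrightarrow> (\<Union>i\<in>I. A i) \<in> clopens X"
  by (induction I rule: finite_induct) (auto simp: clopens_empty clopens_Un)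

lemma distribution_Un:
  "\<mu> \<in> distributions X \<Longrightarrow> A \<in> clopens X \<Longrightarrow> B \<in> clopens X \<Longrightarrow> A \<inter> B = {} \<Longrightarrow>
     \<mu> (A \<union> B) = \<mu> A + \<mu> B"
  by (simp add: distributions_def)

lemma distribution_UN:
  assumes \<mu>: "\<mu> \<in> distributions X" and "finite I"
    and "\<And>i. i \<in> I \<Longrightarrow> A i \<in> clopens X" and "disjoint_family_on A I"
  shows "\<mu> (\<Union>i\<in>I. A i) = (\<Sum>i\<in>I. \<mu> (A i))"
  using assms(2-)
proof (induction I rule: finite_induct)
  case empty
  show ?case using distribution_Un[OF \<mu> clopens_empty clopens_empty] by simp
next
  case (insert i I)
  have "A i \<inter> (\<Union>j\<in>I. A j) = {}"
    using insert.prems(2) insert.hyps(2) by (auto simp: disjoint_family_on_def)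
  moreover have "(\<Union>j\<in>I. A j) \<in> clopens X"
    using insert by (intro clopens_UN) auto
  ultimately have "\<mu> (A i \<union> (\<Union>j\<in>I. A j)) = \<mu> (A i) + \<mu> (\<Union>j\<in>I. A j)"
    using insert.prems(1) by (intro distribution_Un[OF \<mu>]) auto
  moreover have "disjoint_family_on A I"
    using insert.prems(2) by (auto simp: disjoint_family_on_def)
  ultimately show ?case using insert by simp
qed


section \<open>Deck transformations of the boundary\<close>

context based_graph
begin

lemma cover_edge_tree: "edge_tree \<Delta> \<Delta>_rev []"
proof -
  interpret D: bidirected_digraph \<Delta> \<Delta>_rev by (rule cover_bidirected)
  show ?thesis
    by unfold_locales (auto simp: cover_verts awalk_Nil_iff v0 cover_tree(1) dest: cover_tree(2))
qed

lemma deck_arc_inverse: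
  assumes "g \<in> carrier \<Gamma>"
  obtains h where "h \<in> carrier \<Gamma>"
    "\<And>d. d \<in> arcs \<Delta> \<Longrightarrow> deck_arc arev h (deck_arc arev g d) = d"
    "\<And>d. d \<in> arcs \<Delta> \<Longrightarrow> deck_arc arev g (deck_arc arev h d) = d"
proof
  interpret group \<Gamma> by (rule fundamental_group_group)
  let ?h = "inv\<^bsub>\<Gamma>\<^esub> g"
  show h: "?h \<in> carrier \<Gamma>" using assms by simp
  have cancel: "deck_arc arev x (deck_arc arev y d) = d"
    if "x \<in> carrier \<Gamma>" "y \<in> carrier \<Gamma>" "x \<otimes>\<^bsub>\<Gamma>\<^esub> y = \<one>\<^bsub>\<Gamma>\<^esub>" "d \<in> arcs \<Delta>" for x y d
  proof (cases d)
    case (Pair p e)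
    then have "p \<in> verts \<Delta>" using that by (simp add: cover_arcs)
    then show ?thesis
      using deck_action(2)[OF that(1), of p] deck_action(3)[OF that(1,2), of p] that(3) Pair
      by (simp add: deck_arc_def)
  qed
  show "deck_arc arev ?h (deck_arc arev g d) = d" if "d \<in> arcs \<Delta>" for d
    using cancel[OF h assms _ that] assms by simp
  show "deck_arc arev g (deck_arc arev ?h d) = d" if "d \<in> arcs \<Delta>" for d
    using cancel[OF assms h _ that] assms by simp
qed

lemma deck_ray:
  assumes g: "g \<in> carrier \<Gamma>" and s: "s \<in> semi_geodesics \<Delta> \<Delta>_rev"
  shows "deck_arc arev g \<circ> s \<in> semi_geodesics \<Delta> \<Delta>_rev"
proof -
  interpret D: bidirected_digraph \<Delta> \<Delta>_rev by (rule cover_bidirected)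
  obtain h where h: "\<And>d. d \<in> arcs \<Delta> \<Longrightarrow> deck_arc arev h (deck_arc arev g d) = d"
    using deck_arc_inverse[OF g] by metis
  have s': "s i \<in> arcs \<Delta>" "head \<Delta> (s i) = tail \<Delta> (s (Suc i))" "s (Suc i) \<noteq> \<Delta>_rev (s i)" for i
    using s by (auto simp: semi_geodesics_def)
  have "deck_arc arev g (s (Suc i)) \<noteq> \<Delta>_rev (deck_arc arev g (s i))" for i
    using deck_action(4)[OF g s'(1)[of i]] s'(3)[of i] h[OF s'(1)[of "Suc i"]]
      h[of "\<Delta>_rev (s i)"] s'(1)[of i] by (metis D.arev_in_arcs)
  then show ?thesis
    using deck_action(4)[OF g s'(1)] s'(2) by (auto simp: semi_geodesics_def)
qed

lemma deck_same_end:
  assumes "g \<in> carrier \<Gamma>" "(s, s') \<in> end_rel \<Delta> \<Delta>_rev"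
  shows "(deck_arc arev g \<circ> s, deck_arc arev g \<circ> s') \<in> end_rel \<Delta> \<Delta>_rev"
  using assms deck_ray by (auto simp: end_rel_def) metis

text \<open>
  Acting on each ray of an equivalence class gives a whole class, and not just a part of one,
  because the inverse deck transformation brings every ray of the target class back.
\<close>

lemma deck_end_class:
  assumes g: "g \<in> carrier \<Gamma>" and s: "s \<in> semi_geodesics \<Delta> \<Delta>_rev"
  shows "deck_end arev g (end_rel \<Delta> \<Delta>_rev `` {s}) = end_rel \<Delta> \<Delta>_rev `` {deck_arc arev g \<circ> s}"
proof (intro equalityI subsetI)
  fix t assume "t \<in> deck_end arev g (end_rel \<Delta> \<Delta>_rev `` {s})"
  then show "t \<in> end_rel \<Delta> \<Delta>_rev `` {deck_arc arev g \<circ> s}"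
    using deck_same_end[OF g] by (auto simp: deck_end_def)
next
  fix t assume "t \<in> end_rel \<Delta> \<Delta>_rev `` {deck_arc arev g \<circ> s}"
  then have t: "(deck_arc arev g \<circ> s, t) \<in> end_rel \<Delta> \<Delta>_rev" by simp
  obtain h where h: "h \<in> carrier \<Gamma>"
    "\<And>d. d \<in> arcs \<Delta> \<Longrightarrow> deck_arc arev h (deck_arc arev g d) = d"
    "\<And>d. d \<in> arcs \<Delta> \<Longrightarrow> deck_arc arev g (deck_arc arev h d) = d"
    using deck_arc_inverse[OF g] by metis
  have "deck_arc arev h \<circ> (deck_arc arev g \<circ> s) = s"
    using s by (simp add: semi_geodesics_def fun_eq_iff h(2))
  then have "(s, deck_arc arev h \<circ> t) \<in> end_rel \<Delta> \<Delta>_rev"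
    using deck_same_end[OF h(1) t] by simp
  moreover have "t \<in> semi_geodesics \<Delta> \<Delta>_rev" using t by (simp add: end_rel_def)
  then have "deck_arc arev g \<circ> (deck_arc arev h \<circ> t) = t"
    by (simp add: semi_geodesics_def fun_eq_iff h(3))
  ultimately show "t \<in> deck_end arev g (end_rel \<Delta> \<Delta>_rev `` {s})"
    unfolding deck_end_def by (metis Image_singleton_iff image_eqI)
qed

lemma deck_end_Omega:
  assumes g: "g \<in> carrier \<Gamma>" and d: "d \<in> arcs \<Delta>"
  shows "deck_end arev g ` Omega \<Delta> \<Delta>_rev d = Omega \<Delta> \<Delta>_rev (deck_arc arev g d)"
proof (intro equalityI subsetI)
  fix \<xi> assume "\<xi> \<in> deck_end arev g ` Omega \<Delta> \<Delta>_rev d"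
  then obtain s where s: "s \<in> semi_geodesics \<Delta> \<Delta>_rev" "s 0 = d"
    "\<xi> = deck_end arev g (end_rel \<Delta> \<Delta>_rev `` {s})"
    by (auto simp: Omega_def)
  then show "\<xi> \<in> Omega \<Delta> \<Delta>_rev (deck_arc arev g d)"
    using deck_ray[OF g s(1)] deck_end_class[OF g s(1)] by (auto simp: Omega_def)
next
  fix \<xi> assume "\<xi> \<in> Omega \<Delta> \<Delta>_rev (deck_arc arev g d)"
  then obtain s where s: "s \<in> semi_geodesics \<Delta> \<Delta>_rev" "s 0 = deck_arc arev g d"
    "\<xi> = end_rel \<Delta> \<Delta>_rev `` {s}"
    by (auto simp: Omega_def)
  obtain h where h: "h \<in> carrier \<Gamma>"
    "\<And>d. d \<in> arcs \<Delta> \<Longrightarrow> deck_arc arev h (deck_arc arev g d) = d"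
    "\<And>d. d \<in> arcs \<Delta> \<Longrightarrow> deck_arc arev g (deck_arc arev h d) = d"
    using deck_arc_inverse[OF g] by metis
  let ?t = "deck_arc arev h \<circ> s"
  have t: "?t \<in> semi_geodesics \<Delta> \<Delta>_rev" "?t 0 = d"
    using deck_ray[OF h(1) s(1)] s(2) h(2)[OF d] by auto
  moreover have "deck_arc arev g \<circ> ?t = s"
    using s(1) by (simp add: semi_geodesics_def fun_eq_iff h(3))
  ultimately have "\<xi> = deck_end arev g (end_rel \<Delta> \<Delta>_rev `` {?t})"
    using deck_end_class[OF g t(1)] s(3) by simp
  moreover have "end_rel \<Delta> \<Delta>_rev `` {?t} \<in> Omega \<Delta> \<Delta>_rev d"
    using t unfolding Omega_def by blast
  ultimately show "\<xi> \<in> deck_end arev g ` Omega \<Delta> \<Delta>_rev d" by blast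
qed

text \<open>
  The initial vertices of the two arcs lie over the same vertex of \<open>G\<close>, so some deck transformation
  takes one to the other, and hence the first arc to the second.
\<close>

lemma inv_distribution_Omega:
  assumes \<mu>: "\<mu> \<in> inv_distributions G arev v0"
    and p: "(p, e) \<in> arcs \<Delta>" and q: "(q, e) \<in> arcs \<Delta>"
  shows "\<mu> (Omega \<Delta> \<Delta>_rev (p, e)) = \<mu> (Omega \<Delta> \<Delta>_rev (q, e))"
proof -
  interpret tree: edge_tree \<Delta> \<Delta>_rev "[]" by (rule cover_edge_tree)
  obtain g where g: "g \<in> carrier \<Gamma>" "reduced_concat arev g p = q"
    using deck_orbits[of p q] p q by (auto simp: cover_arcs)
  then have "deck_end arev g ` Omega \<Delta> \<Delta>_rev (p, e) = Omega \<Delta> \<Delta>_rev (q, e)"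
    using deck_end_Omega[OF g(1) p] by (simp add: deck_arc_def)
  moreover have "\<mu> (deck_end arev g ` Omega \<Delta> \<Delta>_rev (p, e)) = \<mu> (Omega \<Delta> \<Delta>_rev (p, e))"
    using \<mu> g(1) tree.Omega_clopen[OF p] by (simp add: inv_distributions_def)
  ultimately show ?thesis by simp
qed

end


section \<open>Counting edges twice\<close>

lemma int_mult_diff:
  "int_mult (int a - int b) (m :: 'm::ab_group_add) = (\<Sum>i<a. m) - (\<Sum>i<b. m)"
proof -
  have split: "(\<Sum>i<k + l. m) = (\<Sum>i<k. m) + (\<Sum>i<l. m)" for k l :: nat
    by (induction l) (auto simp: algebra_simps)
  show ?thesis
  proof (cases "b \<le> a")
    case True
    then obtain c where "a = b + c" using le_Suc_ex by blast
    then show ?thesis by (simp add: int_mult_def split)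
  next
    case False
    then obtain c where "b = a + c" "c > 0" using less_imp_add_positive by (metis not_le)
    then show ?thesis by (simp add: int_mult_def split)
  qed
qed

lemma sum_const_card:
  "finite A \<Longrightarrow> (\<Sum>x\<in>A. (m :: 'm::ab_group_add)) = (\<Sum>i<card A. m)"
  by (induction A rule: finite_induct) (auto simp: add.commute)

text \<open>
  The sum of \<open>f\<close> over all arcs is \<open>n\<^sub>0 \<sqdot> m\<close> when the arcs are grouped by their tails, and
  \<open>n\<^sub>1 \<sqdot> m\<close> when each arc is paired with its reverse. The pairs have two elements also for loops,
  as an arc differs from its reverse.
\<close>

lemma euler_char_mult_eq_0:
  fixes f :: "'b \<Rightarrow> 'm::ab_group_add"
  assumes "bidirected_digraph G arev" "fin_digraph G"
    and star: "\<And>v. v \<in> verts G \<Longrightarrow> (\<Sum>e\<in>out_arcs G v. f e) = m"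
    and edge: "\<And>e. e \<in> arcs G \<Longrightarrow> f e + f (arev e) = m"
  shows "int_mult (euler_char G arev) m = 0"
proof -
  interpret bidirected_digraph G arev by fact
  interpret fin_digraph G by fact
  have fin: "finite (geom_edges G arev)" by (simp add: geom_edges_def)
  have arcs_v: "arcs G = (\<Union>v\<in>verts G. out_arcs G v)" by auto
  have arcs_e: "arcs G = \<Union> (geom_edges G arev)" by (auto simp: geom_edges_def)
  have "(\<Sum>e\<in>arcs G. f e) = (\<Sum>v\<in>verts G. \<Sum>e\<in>out_arcs G v. f e)"
    unfolding arcs_v by (rule sum.UNION_disjoint) auto
  then have v: "(\<Sum>e\<in>arcs G. f e) = (\<Sum>i<card (verts G). m)"
    using star by (simp add: sum_const_card[OF finite_verts])
  have "(\<Sum>e\<in>arcs G. f e) = (\<Sum>x\<in>geom_edges G arev. \<Sum>e\<in>x. f e)"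
    unfolding arcs_e
  proof (rule sum.Union_disjoint[unfolded comp_def])
    show "\<forall>x\<in>geom_edges G arev. finite x" by (auto simp: geom_edges_def)
    show "\<forall>x\<in>geom_edges G arev. \<forall>y\<in>geom_edges G arev. x \<noteq> y \<longrightarrow> x \<inter> y = {}"
      by (auto simp: geom_edges_def) (metis arev_arev)+
  qed
  moreover have "(\<Sum>e\<in>x. f e) = m" if x: "x \<in> geom_edges G arev" for x
  proof -
    obtain a where a: "a \<in> arcs G" "x = {a, arev a}" using x by (auto simp: geom_edges_def)
    then show ?thesis using edge[OF a(1)] arev_neq[OF a(1)] by simp
  qed
  ultimately have e: "(\<Sum>e\<in>arcs G. f e) = (\<Sum>i<card (geom_edges G arev). m)"
    by (simp add: sum_const_card[OF fin])
  show ?thesis using v e by (simp add: euler_char_def int_mult_diff)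
qed

text \<open>
  The function \<open>f\<close> on the arcs of \<open>G\<close> is read off from a choice \<open>\<sigma>\<close> of one vertex of the tree over
  each vertex of \<open>G\<close>.
\<close>

lemma (in based_graph) euler_char_mult_total_mass:
  fixes \<mu> :: "(nat \<Rightarrow> 'b list \<times> 'b) set set \<Rightarrow> 'm::ab_group_add"
  assumes "fin_digraph G" and \<mu>: "\<mu> \<in> inv_distributions G arev v0"
  shows "int_mult (euler_char G arev) (\<mu> (cover_boundary G arev v0)) = 0"
proof -
  interpret fin_digraph G by fact
  interpret tree: edge_tree \<Delta> \<Delta>_rev "[]" by (rule cover_edge_tree)
  have dist: "\<mu> \<in> distributions (cover_boundary_topology G arev v0)"
    using \<mu> by (simp add: inv_distributions_def)
  have "\<forall>v\<in>verts G. \<exists>p. p \<in> verts \<Delta> \<and> proj p = v"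
    using cover_covering(1) by (metis imageE)
  then obtain \<sigma> where \<sigma>: "\<And>v. v \<in> verts G \<Longrightarrow> \<sigma> v \<in> verts \<Delta> \<and> proj (\<sigma> v) = v"
    by (auto dest!: bchoice)
  define f where "f e = \<mu> (Omega \<Delta> \<Delta>_rev (\<sigma> (tail G e), e))" for e
  have lift: "(\<sigma> (tail G e), e) \<in> arcs \<Delta>" if "e \<in> arcs G" for e
    using \<sigma>[of "tail G e"] that by (simp add: cover_arcs)
  show ?thesis
  proof (rule euler_char_mult_eq_0[OF bidirected_digraph_axioms assms(1)])
    fix v assume v: "v \<in> verts G"
    have bij: "bij_betw snd (out_arcs \<Delta> (\<sigma> v)) (out_arcs G v)"
      using cover_covering(3)[of "\<sigma> v"] \<sigma>[OF v] by simp
    have "(\<Sum>e\<in>out_arcs G v. f e) = (\<Sum>d\<in>out_arcs \<Delta> (\<sigma> v). f (snd d))"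
      using sum.reindex_bij_betw[OF bij] by metis
    also have "\<dots> = (\<Sum>d\<in>out_arcs \<Delta> (\<sigma> v). \<mu> (Omega \<Delta> \<Delta>_rev d))"
      by (rule sum.cong) (use \<sigma>[OF v] in \<open>auto simp: f_def cover_arcs\<close>)
    also have "\<dots> = \<mu> (\<Union>d\<in>out_arcs \<Delta> (\<sigma> v). Omega \<Delta> \<Delta>_rev d)"
    proof (rule distribution_UN[OF dist, symmetric])
      show "finite (out_arcs \<Delta> (\<sigma> v))"
        using bij_betw_finite[OF bij] finite_subset[OF _ finite_arcs, of "out_arcs G v"] by auto
      show "disjoint_family_on (Omega \<Delta> \<Delta>_rev) (out_arcs \<Delta> (\<sigma> v))"
        using tree.Omega_disjoint by (fastforce simp: disjoint_family_on_def)
    qed (simp add: tree.Omega_clopen)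
    finally show "(\<Sum>e\<in>out_arcs G v. f e) = \<mu> (cover_boundary G arev v0)"
      using tree.ends_eq_UN_Omega[of "\<sigma> v"] \<sigma>[OF v] by simp
  next
    fix e assume e: "e \<in> arcs G"
    let ?d = "(\<sigma> (tail G e), e)"
    have d: "?d \<in> arcs \<Delta>" "\<Delta>_rev ?d \<in> arcs \<Delta>" using lift[OF e] by simp_all
    \<comment> \<open>The reverse of the chosen lift of \<open>e\<close> need not be the chosen lift of \<open>arev e\<close>, only
      a translate of it.\<close>
    have "\<Delta>_rev ?d = (extend arev (\<sigma> (tail G e)) e, arev e)"
      using d(1) by (simp add: cover_rev_def)
    then have "f (arev e) = \<mu> (Omega \<Delta> \<Delta>_rev (\<Delta>_rev ?d))"
      using inv_distribution_Omega[OF \<mu> lift, of "arev e"] d(2) e by (simp add: f_def)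
    moreover have "\<mu> (Omega \<Delta> \<Delta>_rev ?d \<union> Omega \<Delta> \<Delta>_rev (\<Delta>_rev ?d))
        = \<mu> (Omega \<Delta> \<Delta>_rev ?d) + \<mu> (Omega \<Delta> \<Delta>_rev (\<Delta>_rev ?d))"
      using d tree.Omega_trev[OF d(1)] by (intro distribution_Un[OF dist] tree.Omega_clopen) auto
    moreover have "Omega \<Delta> \<Delta>_rev ?d \<union> Omega \<Delta> \<Delta>_rev (\<Delta>_rev ?d) = cover_boundary G arev v0"
      using tree.Omega_trev[OF d(1)] tree.Omega_subset[of ?d] by auto
    ultimately show "f e + f (arev e) = \<mu> (cover_boundary G arev v0)"
      by (simp add: f_def)
  qed
qed

theorem proposition2p6:
  fixes G :: "('a, 'b) pre_digraph" and arev :: "'b \<Rightarrow> 'b" and v0 :: 'a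
  assumes "bidirected_digraph G arev" and "fin_digraph G" and "connected G"
    and "v0 \<in> verts G"
    and "\<And>m :: 'm::ab_group_add. int_mult (euler_char G arev) m = 0 \<Longrightarrow> m = 0"
  shows "(inv_distributions G arev v0 :: ((nat \<Rightarrow> 'b list \<times> 'b) set set \<Rightarrow> 'm) set)
       = inv_distributions0 G arev v0"
proof -
  interpret bidirected_digraph G arev by fact
  interpret based_graph G arev v0
    by unfold_locales (use assms in auto)
  show ?thesis
    using euler_char_mult_total_mass[OF assms(2)] assms(5)
    by (auto simp: inv_distributions0_def)
qed

end
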